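(* Let $\beta$ be a weak composition of $n$ and let $k\in\mathbb{Z}_{\ge0}$. Then \[ \sum_{\mu\in\mathcal{OP}_{\beta,k}} q^{\mathrm{inv}(\mu)}=\sum_{\mu\in\mathcal{OP}_{\beta,k}} q^{\mathrm{minimaj}(\mu)}. \]
   Context: A weak composition $\beta=(\beta_1,\beta_2,\dots,\beta_m)$ of $n$ is a finite sequence of nonnegative integers summing to $n$. An ordered multiset partition of weight $\beta$ is a sequence $\mu=(B_1|\dots|B_k)$ of nonempty sets of positive integers (blocks; no block contains a repeated letter) whose multiset union is $\{1^{\beta_1},2^{\beta_2},\dots\}$. $\mathcal{OP}_{\beta,k}$ is the set of ordered multiset partitions of weight $\beta$ with $k$ blocks. An inversion of $\mu$ is a pair of letters $i<j$ such that $i=\min(B_m)$ and $j\in B_\ell$ for some $\ell<m$ (counted once for each such occurrence of $j$ in a block $B_\ell$); $\mathrm{inv}(\mu)$ is the number of inversions. For a word $w=w_1\dots w_n$, $\mathrm{maj}(w)=\sum_{i:w_i>w_{i+1}}i$. $W(\mu)$ is the set of words obtained by writing the blocks of $\mu$ in order with the letters within each block in any order, and $\mathrm{minimaj}(\mu)=\min\{\mathrm{maj}(w):w\in W(\mu)\}$. *)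

theory Defs
  imports Main "HOL-Library.Multiset" "HOL-Computational_Algebra.Polynomial"
begin

text \<open>A weak composition is a list of natural numbers. The list is indexed from 0, so the
  part \<open>\<beta>\<^sub>i\<close> belonging to the letter \<open>i \<ge> 1\<close> is \<open>\<beta> ! (i - 1)\<close>.\<close>

definition weak_composition :: "nat \<Rightarrow> nat list \<Rightarrow> bool" where
  "weak_composition n \<beta> \<longleftrightarrow> sum_list \<beta> = n"

definition weight_mset :: "nat list \<Rightarrow> nat multiset" where
  "weight_mset \<beta> = (\<Sum>i<length \<beta>. replicate_mset (\<beta> ! i) (Suc i))"

text \<open>Finiteness of the blocks is explicit because \<open>mset_set\<close> sends infinite sets to the empty
  multiset.\<close>

definition ordered_multiset_partitions :: "nat list \<Rightarrow> nat \<Rightarrow> nat set list set" where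
  "ordered_multiset_partitions \<beta> k =
     {\<mu>. length \<mu> = k \<and> (\<forall>B\<in>set \<mu>. finite B \<and> B \<noteq> {} \<and> (\<forall>a\<in>B. 0 < a)) \<and>
         sum_list (map mset_set \<mu>) = weight_mset \<beta>}"

text \<open>An inversion is recorded as \<open>(l, m, j)\<close>: the letter \<open>j\<close> of block \<open>l\<close> exceeds the minimum
  of the later block \<open>m\<close>.\<close>

definition inversions :: "nat set list \<Rightarrow> (nat \<times> nat \<times> nat) set" where
  "inversions \<mu> = {(l, m, j). l < m \<and> m < length \<mu> \<and> j \<in> \<mu> ! l \<and> Min (\<mu> ! m) < j}"

definition inv_stat :: "nat set list \<Rightarrow> nat" where
  "inv_stat \<mu> = card (inversions \<mu>)"

text \<open>The descent between positions \<open>i\<close> and \<open>i + 1\<close> (counted from 0) contributes \<open>i + 1\<close>.\<close>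

definition maj :: "nat list \<Rightarrow> nat" where
  "maj w = (\<Sum>i | Suc i < length w \<and> w ! i > w ! Suc i. Suc i)"

definition block_words :: "nat set list \<Rightarrow> nat list set" where
  "block_words \<mu> = {concat ws | ws. list_all2 (\<lambda>u B. distinct u \<and> set u = B) ws \<mu>}"

definition minimaj :: "nat set list \<Rightarrow> nat" where
  "minimaj \<mu> = Min (maj ` block_words \<mu>)"

text \<open>The sets over which \<open>sum\<close>, \<open>card\<close> and \<open>Min\<close> are taken are finite, and nonempty in the
  case of \<open>Min\<close>.\<close>

lemma set_mset_sum_list: "set_mset (sum_list Ms) = (\<Union>M\<in>set Ms. set_mset M)"
  by (induction Ms) auto

lemma finite_ordered_multiset_partitions: "finite (ordered_multiset_partitions \<beta> k)"
proof (rule finite_subset)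
  let ?S = "Pow (set_mset (weight_mset \<beta>))"
  show "ordered_multiset_partitions \<beta> k \<subseteq> {\<mu>. set \<mu> \<subseteq> ?S \<and> length \<mu> = k}"
  proof
    fix \<mu> assume mu: "\<mu> \<in> ordered_multiset_partitions \<beta> k"
    then have "weight_mset \<beta> = sum_list (map mset_set \<mu>)"
      by (simp add: ordered_multiset_partitions_def)
    then have eq: "set_mset (weight_mset \<beta>) = (\<Union>B\<in>set \<mu>. set_mset (mset_set B))"
      by (simp add: set_mset_sum_list)
    have "B \<subseteq> set_mset (weight_mset \<beta>)" if B: "B \<in> set \<mu>" for B
    proof -
      have "finite B" using mu B by (auto simp: ordered_multiset_partitions_def)
      then have "B = set_mset (mset_set B)" by simp
      then show ?thesis using eq B by blast
    qed
    with mu show "\<mu> \<in> {\<mu>. set \<mu> \<subseteq> ?S \<and> length \<mu> = k}"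
      by (auto simp: ordered_multiset_partitions_def)
  qed
  show "finite {\<mu>. set \<mu> \<subseteq> ?S \<and> length \<mu> = k}"
    by (rule finite_lists_length_eq) simp
qed

lemma finite_inversions:
  assumes "\<And>B. B \<in> set \<mu> \<Longrightarrow> finite B"
  shows "finite (inversions \<mu>)"
proof (rule finite_subset)
  show "inversions \<mu> \<subseteq> {..<length \<mu>} \<times> {..<length \<mu>} \<times> \<Union> (set \<mu>)"
  proof
    fix x assume "x \<in> inversions \<mu>"
    then obtain l m j where x: "x = (l, m, j)" "l < m" "m < length \<mu>" "j \<in> \<mu> ! l"
      by (auto simp: inversions_def)
    then have "\<mu> ! l \<in> set \<mu>" by simp
    with x show "x \<in> {..<length \<mu>} \<times> {..<length \<mu>} \<times> \<Union> (set \<mu>)" by auto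
  qed
  show "finite ({..<length \<mu>} \<times> {..<length \<mu>} \<times> \<Union> (set \<mu>))"
    using assms by auto
qed

lemma block_words_Nil: "block_words [] = {[]}"
  by (auto simp: block_words_def)

lemma block_words_Cons:
  "block_words (B # \<mu>) = (\<lambda>(u, w). u @ w) ` ({u. distinct u \<and> set u = B} \<times> block_words \<mu>)"
proof (intro set_eqI iffI)
  fix x assume "x \<in> block_words (B # \<mu>)"
  then obtain u ws where "x = u @ concat ws" "distinct u" "set u = B"
    "list_all2 (\<lambda>u B. distinct u \<and> set u = B) ws \<mu>"
    by (auto simp: block_words_def list_all2_Cons2)
  then show "x \<in> (\<lambda>(u, w). u @ w) ` ({u. distinct u \<and> set u = B} \<times> block_words \<mu>)"
    by (intro image_eqI[where x = "(u, concat ws)"]) (auto simp: block_words_def)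
next
  fix x assume "x \<in> (\<lambda>(u, w). u @ w) ` ({u. distinct u \<and> set u = B} \<times> block_words \<mu>)"
  then obtain u ws where "x = concat (u # ws)" "distinct u" "set u = B"
    "list_all2 (\<lambda>u B. distinct u \<and> set u = B) ws \<mu>"
    by (auto simp: block_words_def)
  then show "x \<in> block_words (B # \<mu>)"
    unfolding block_words_def by (intro CollectI exI[where x = "u # ws"]) simp
qed

lemma finite_block_words:
  assumes "\<And>B. B \<in> set \<mu> \<Longrightarrow> finite B"
  shows "finite (block_words \<mu>)" and "block_words \<mu> \<noteq> {}"
proof -
  have "finite (block_words \<mu>) \<and> block_words \<mu> \<noteq> {}"
    using assms
  proof (induction \<mu>)
    case Nil
    then show ?case by (simp add: block_words_Nil)
  next
    case (Cons B \<mu>)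
    then have B: "finite B" by simp
    have "finite {u. distinct u \<and> set u = B}"
      by (rule finite_subset[OF _ finite_subset_distinct[OF B]]) auto
    moreover have "{u. distinct u \<and> set u = B} \<noteq> {}"
      using finite_distinct_list[OF B] by auto
    ultimately show ?case
      using Cons by (auto simp: block_words_Cons)
  qed
  then show "finite (block_words \<mu>)" and "block_words \<mu> \<noteq> {}" by auto
qed

end

theory Submission
  imports Defs
begin

text \<open>
  Both statistics obey the same recursion on the last block. If \<open>S\<close> is the last block and
  \<open>r = Min S\<close>, then \<open>S\<close> adds to \<open>inv\<close> the number \<open>c\<close> of letters \<open>> r\<close> in the earlier blocks.
  For every word \<open>w\<close>, rotating the alphabet cyclically so that \<open>r\<close> becomes the largest letter
  turns \<open>maj (w r)\<close> into \<open>maj w\<close> plus the number of letters \<open>> r\<close> of \<open>w\<close>, so minimaj of the whole is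
  \<open>c\<close> plus minimaj of the relabelled earlier blocks. By induction on the number of blocks it
  therefore suffices that the distribution of \<open>inv\<close> does not change when the alphabet is permuted.

  Let \<open>F(\<beta>, k)\<close> be the generating function of \<open>inv\<close> and let \<open>e\<^sub>b(N)\<close> be the elementary symmetric
  polynomial in \<open>1, q, \<dots>, q\<^bsup>N-1\<^esup>\<close>. The last-block recursion for \<open>F\<close> matches the telescoped
  difference of the right-hand side between \<open>N\<close> and \<open>N + 1\<close> in
  \<open>\<Sum>\<^sub>k e\<^sub>k(N) F(\<beta>, k) = \<Prod>\<^sub>i e\<^bsub>\<beta>\<^sub>i\<^esub>(N)\<close>. This identity is symmetric in \<open>\<beta>\<close> and, being triangular
  in \<open>N\<close>, determines \<open>F(\<beta>, k)\<close>.
\<close>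

section \<open>Ordered multiset partitions of a multiset\<close>

text \<open>Weights are arbitrary multisets, so that the family is closed under removing a block and
  under injective relabelling of the letters.\<close>

definition omp :: "nat multiset \<Rightarrow> nat \<Rightarrow> nat set list set" where
  "omp M k = {\<mu>. length \<mu> = k \<and> (\<forall>B\<in>set \<mu>. finite B \<and> B \<noteq> {}) \<and>
     sum_list (map mset_set \<mu>) = M}"

lemma ordered_multiset_partitions_eq_omp:
  "ordered_multiset_partitions \<beta> k = omp (weight_mset \<beta>) k"
proof -
  have pos: "0 < a" if "a \<in># weight_mset \<beta>" for a
    using that by (auto simp: weight_mset_def set_mset_sum split: if_splits)
  have "0 < a" if "\<mu> \<in> omp (weight_mset \<beta>) k" "B \<in> set \<mu>" "a \<in> B" for \<mu> B a
  proof -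
    have "finite B" using that by (auto simp: omp_def)
    then have "a \<in># sum_list (map mset_set \<mu>)"
      using that by (auto simp: set_mset_sum_list intro!: bexI[of _ B])
    moreover have "sum_list (map mset_set \<mu>) = weight_mset \<beta>"
      using that(1) by (simp add: omp_def)
    ultimately show ?thesis using pos by simp
  qed
  then show ?thesis
    by (auto simp: ordered_multiset_partitions_def omp_def)
qed

lemma finite_block_omp: "\<mu> \<in> omp M k \<Longrightarrow> B \<in> set \<mu> \<Longrightarrow> finite B"
  by (auto simp: omp_def)

lemma Union_omp:
  assumes "\<mu> \<in> omp M k"
  shows "\<Union>(set \<mu>) = set_mset M"
proof -
  have "M = sum_list (map mset_set \<mu>)"
    using assms by (simp add: omp_def)
  then have "set_mset M = (\<Union>B\<in>set \<mu>. set_mset (mset_set B))"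
    by (simp add: set_mset_sum_list)
  also have "\<dots> = (\<Union>B\<in>set \<mu>. B)"
    by (intro SUP_cong) (simp_all add: finite_block_omp[OF assms])
  finally show ?thesis by simp
qed

lemma finite_omp: "finite (omp M k)"
proof (rule finite_subset)
  show "omp M k \<subseteq> {\<mu>. set \<mu> \<subseteq> Pow (set_mset M) \<and> length \<mu> = k}"
    using Union_omp by (fastforce simp: omp_def)
  show "finite {\<mu>. set \<mu> \<subseteq> Pow (set_mset M) \<and> length \<mu> = k}"
    by (rule finite_lists_length_eq) simp
qed

lemma omp_0: "omp M 0 = (if M = {#} then {[]} else {})"
  by (auto simp: omp_def)

lemma sum_omp_Suc:
  fixes g :: "nat set list \<Rightarrow> 'a::comm_monoid_add"
  shows "(\<Sum>\<mu>\<in>omp M (Suc k). g \<mu>) =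
    (\<Sum>S\<in>Pow (set_mset M) - {{}}. \<Sum>\<nu>\<in>omp (M - mset_set S) k. g (\<nu> @ [S]))"
proof -
  let ?A = "SIGMA S:Pow (set_mset M) - {{}}. omp (M - mset_set S) k"
  let ?h = "\<lambda>p. snd p @ [fst p]"
  have sub: "\<mu> \<in> ?h ` ?A" if mu: "\<mu> \<in> omp M (Suc k)" for \<mu>
  proof -
    have "\<mu> \<noteq> []" using mu by (auto simp: omp_def)
    then obtain \<nu> S where eq: "\<mu> = \<nu> @ [S]" by (cases \<mu> rule: rev_cases) auto
    then have "S \<in> set \<mu>" by simp
    then have "S \<subseteq> set_mset M" using Union_omp[OF mu] by blast
    moreover have M: "M = sum_list (map mset_set \<nu>) + mset_set S"
      and "S \<noteq> {}" "length \<nu> = k" "\<forall>B\<in>set \<nu>. finite B \<and> B \<noteq> {}"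
      using mu unfolding eq by (simp_all add: omp_def)
    moreover have "\<nu> \<in> omp (M - mset_set S) k"
      unfolding M using calculation by (simp add: omp_def)
    ultimately show ?thesis using eq by (intro image_eqI[of _ _ "(S, \<nu>)"]) auto
  qed
  have sup: "\<nu> @ [S] \<in> omp M (Suc k)"
    if "S \<subseteq> set_mset M" "S \<noteq> {}" "\<nu> \<in> omp (M - mset_set S) k" for S \<nu>
  proof -
    have "finite S" using that finite_subset by blast
    \<comment> \<open>Multiset difference truncates, so adding \<open>S\<close> back to
      \<open>M - mset_set S\<close> restores \<open>M\<close> only because every letter of
      \<open>S\<close> occurs in \<open>M\<close>.\<close>
    have "mset_set S \<subseteq># mset_set (set_mset M)"
      using that by (intro subset_imp_msubset_mset_set) auto
    then have "mset_set S \<subseteq># M"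
      using mset_set_set_mset_msubset subset_mset.order_trans by blast
    then show ?thesis
      using that \<open>finite S\<close> by (auto simp: omp_def)
  qed
  have "?h p \<in> omp M (Suc k)" if "p \<in> ?A" for p
    using that sup[of "fst p" "snd p"] by (cases p) simp
  with sub have "omp M (Suc k) = ?h ` ?A"
    by (intro equalityI subsetI) blast+
  moreover have "inj_on ?h ?A" by (auto simp: inj_on_def)
  ultimately have "(\<Sum>\<mu>\<in>omp M (Suc k). g \<mu>) = (\<Sum>p\<in>?A. g (?h p))"
    by (simp add: sum.reindex)
  also have "\<dots> = (\<Sum>S\<in>Pow (set_mset M) - {{}}. \<Sum>\<nu>\<in>omp (M - mset_set S) k. g (\<nu> @ [S]))"
    by (subst sum.Sigma) (auto simp: finite_omp split_beta)
  finally show ?thesis .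
qed

lemma image_mset_sum_list: "image_mset f (sum_list Ms) = sum_list (map (image_mset f) Ms)"
  by (induction Ms) auto

lemma map_image_omp:
  assumes "\<mu> \<in> omp M k" "inj_on f (set_mset M)"
  shows "map ((`) f) \<mu> \<in> omp (image_mset f M) k"
proof -
  have "inj_on f B" if "B \<in> set \<mu>" for B
    using Union_omp[OF assms(1)] assms(2) that by (blast intro: inj_on_subset)
  then have "map (image_mset f) (map mset_set \<mu>) = map mset_set (map ((`) f) \<mu>)"
    by (simp add: image_mset_mset_set)
  moreover have "M = sum_list (map mset_set \<mu>)"
    using assms(1) by (simp add: omp_def)
  ultimately have "sum_list (map mset_set (map ((`) f) \<mu>)) = image_mset f M"
    by (simp only: image_mset_sum_list)
  then show ?thesis
    using assms(1) by (auto simp: omp_def)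
qed

lemma map_image_inverse:
  assumes "\<And>x. x \<in> \<Union>(set \<mu>) \<Longrightarrow> g (f x) = x"
  shows "map ((`) g) (map ((`) f) \<mu>) = \<mu>"
proof -
  have "g ` f ` B = B" if "B \<in> set \<mu>" for B
  proof -
    have "g (f x) = x" if "x \<in> B" for x using assms that \<open>B \<in> set \<mu>\<close> by blast
    then show ?thesis by (simp add: image_image)
  qed
  then show ?thesis by (simp add: map_idI)
qed

lemma sum_omp_relabel:
  fixes h :: "nat set list \<Rightarrow> 'a::comm_monoid_add"
  assumes inj: "inj_on f (set_mset M)"
  shows "(\<Sum>\<mu>\<in>omp M k. h (map ((`) f) \<mu>)) = (\<Sum>\<mu>\<in>omp (image_mset f M) k. h \<mu>)"
proof -
  define g where "g = the_inv_into (set_mset M) f"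
  have gf: "g (f x) = x" if "x \<in># M" for x
    using inj that by (simp add: g_def the_inv_into_f_f)
  have fg: "f (g y) = y" if "y \<in># image_mset f M" for y
    using gf that by auto
  have injg: "inj_on g (set_mset (image_mset f M))"
    by (rule inj_on_inverseI[of _ f]) (use fg in auto)
  have gM: "image_mset g (image_mset f M) = M"
    using gf by (simp add: multiset.map_comp comp_def multiset.map_ident_strong)
  show ?thesis
  proof (rule sum.reindex_bij_witness[where i = "map ((`) g)" and j = "map ((`) f)"])
    fix \<mu> assume mu: "\<mu> \<in> omp M k"
    show "map ((`) g) (map ((`) f) \<mu>) = \<mu>"
      by (rule map_image_inverse) (use Union_omp[OF mu] gf in auto)
    show "map ((`) f) \<mu> \<in> omp (image_mset f M) k"
      using map_image_omp[OF mu inj] .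
  next
    fix \<mu> assume mu: "\<mu> \<in> omp (image_mset f M) k"
    show "map ((`) f) (map ((`) g) \<mu>) = \<mu>"
      by (rule map_image_inverse) (use Union_omp[OF mu] fg in auto)
    show "map ((`) g) \<mu> \<in> omp M k"
      using map_image_omp[OF mu injg] gM by simp
  qed simp
qed

section \<open>The inversion generating function\<close>

text \<open>The new inversions are those whose later block is \<open>S\<close>. A letter counts once
  for each earlier block containing it, hence a multiset size.\<close>

lemma inv_stat_snoc:
  assumes fin: "\<And>B. B \<in> set \<nu> \<Longrightarrow> finite B"
  shows "inv_stat (\<nu> @ [S]) =
    inv_stat \<nu> + size (filter_mset (\<lambda>x. Min S < x) (sum_list (map mset_set \<nu>)))"
proof -
  let ?J = "\<lambda>l. {j \<in> \<nu> ! l. Min S < j}"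
  let ?new = "(\<lambda>(l, j). (l, length \<nu>, j)) ` (SIGMA l:{..<length \<nu>}. ?J l)"
  have split: "inversions (\<nu> @ [S]) = inversions \<nu> \<union> ?new"
    by (auto simp: inversions_def nth_append less_Suc_eq image_iff)
  have fin_nth: "finite (\<nu> ! l)" if "l < length \<nu>" for l
    using fin that by simp
  have fin_new: "finite ?new"
    using fin_nth by (intro finite_imageI finite_SigmaI) auto
  have "card ?new = (\<Sum>l<length \<nu>. card (?J l))"
    using fin_nth by (subst card_image) (auto simp: inj_on_def)
  also have "\<dots> = (\<Sum>l<length \<nu>. size (filter_mset (\<lambda>x. Min S < x) (mset_set (\<nu> ! l))))"
    using fin_nth by (intro sum.cong) auto
  also have "\<dots> = (\<Sum>B\<leftarrow>\<nu>. size (filter_mset (\<lambda>x. Min S < x) (mset_set B)))"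
    by (simp add: sum_list_sum_nth atLeast0LessThan)
  also have "\<dots> = size (filter_mset (\<lambda>x. Min S < x) (sum_list (map mset_set \<nu>)))"
    by (induction \<nu>) auto
  finally have "card ?new = size (filter_mset (\<lambda>x. Min S < x) (sum_list (map mset_set \<nu>)))" .
  moreover have "inversions \<nu> \<inter> ?new = {}"
    by (auto simp: inversions_def)
  ultimately show ?thesis
    using split fin_new finite_inversions[of \<nu>] fin
    by (simp add: inv_stat_def card_Un_disjoint)
qed

text \<open>An integral domain allows nonzero factors to be cancelled; the indeterminate of an
  integer polynomial ring is one possible \<open>q\<close>.\<close>

definition inv_gf :: "'a::idom \<Rightarrow> nat multiset \<Rightarrow> nat \<Rightarrow> 'a" where
  "inv_gf q M k = (\<Sum>\<mu>\<in>omp M k. q ^ inv_stat \<mu>)"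

lemma inv_gf_0: "inv_gf q M 0 = (if M = {#} then 1 else 0)"
proof -
  have "inversions [] = {}" by (auto simp: inversions_def)
  then show ?thesis by (simp add: inv_gf_def omp_0 inv_stat_def)
qed

text \<open>The contribution of the last block depends on the earlier blocks only through their
  multiset union, so it factors out of the inner sum.\<close>

lemma inv_gf_Suc:
  "inv_gf q M (Suc k) = (\<Sum>S\<in>Pow (set_mset M) - {{}}.
     q ^ size (filter_mset (\<lambda>x. Min S < x) (M - mset_set S)) * inv_gf q (M - mset_set S) k)"
proof -
  have "(\<Sum>\<nu>\<in>omp M' k. q ^ inv_stat (\<nu> @ [S])) =
      q ^ size (filter_mset (\<lambda>x. Min S < x) M') * inv_gf q M' k" for M' S
  proof -
    have "q ^ inv_stat (\<nu> @ [S]) = q ^ size (filter_mset (\<lambda>x. Min S < x) M') * q ^ inv_stat \<nu>"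
      if "\<nu> \<in> omp M' k" for \<nu>
    proof -
      have "sum_list (map mset_set \<nu>) = M'" using that by (simp add: omp_def)
      then show ?thesis
        using inv_stat_snoc[of \<nu> S] finite_block_omp[OF that] by (simp add: power_add mult.commute)
    qed
    then show ?thesis by (simp add: inv_gf_def sum_distrib_left)
  qed
  then show ?thesis by (simp add: inv_gf_def sum_omp_Suc)
qed

text \<open>\<open>qelem q N b\<close> is the elementary symmetric polynomial of degree \<open>b\<close> in
  \<open>1, q, \<dots>, q\<^bsup>N-1\<^esup>\<close>, that is, \<open>q\<close> to the power \<open>b choose 2\<close> times a Gaussian binomial.\<close>

fun qelem :: "'a::idom \<Rightarrow> nat \<Rightarrow> nat \<Rightarrow> 'a" where
  "qelem q N 0 = 1"
| "qelem q 0 (Suc b) = 0"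
| "qelem q (Suc N) (Suc b) = qelem q N (Suc b) + q ^ N * qelem q N b"

text \<open>The second q-Pascal rule: the defining equation splits off the largest variable
  \<open>q ^ N\<close>, this one the variable 1. The others are then \<open>q\<close> times
  \<open>1, ..., q ^ (N - 1)\<close>, and homogeneity yields the powers of \<open>q\<close>.\<close>

lemma qelem_Suc_Suc':
  "qelem q (Suc N) (Suc b) = q ^ Suc b * qelem q N (Suc b) + q ^ b * qelem q N b"
proof (induction N arbitrary: b)
  case 0
  then show ?case by (cases b) auto
next
  case (Suc N)
  show ?case
  proof (cases b)
    case 0
    have "qelem q (Suc (Suc N)) (Suc 0) = qelem q (Suc N) (Suc 0) + q ^ Suc N"
      by simp
    also have "\<dots> = q * qelem q N (Suc 0) + 1 + q ^ Suc N"
      using Suc[of 0] by (simp only: power_0 power_Suc mult_1_right mult_1_left qelem.simps(1))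
    also have "\<dots> = q * qelem q (Suc N) (Suc 0) + 1"
      by (simp add: algebra_simps)
    finally show ?thesis by (simp add: 0)
  next
    case b: (Suc c)
    have "qelem q (Suc (Suc N)) (Suc b) = qelem q (Suc N) (Suc b) + q ^ Suc N * qelem q (Suc N) b"
      by simp
    also have "\<dots> = (q ^ Suc b * qelem q N (Suc b) + q ^ b * qelem q N b) +
        q ^ Suc N * (q ^ Suc c * qelem q N (Suc c) + q ^ c * qelem q N c)"
      using Suc[of b] Suc[of c] b by (simp only:)
    also have "\<dots> = q ^ Suc b * (qelem q N (Suc b) + q ^ N * qelem q N b) +
        q ^ b * (qelem q N (Suc c) + q ^ N * qelem q N c)"
      by (simp add: b algebra_simps)
    also have "\<dots> = q ^ Suc b * qelem q (Suc N) (Suc b) + q ^ b * qelem q (Suc N) b"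
      by (simp add: b)
    finally show ?thesis .
  qed
qed

lemma qelem_eq_0: "N < b \<Longrightarrow> qelem q N b = 0"
  by (induction q N b rule: qelem.induct) auto

text \<open>Only the product of all variables survives, a power of \<open>q\<close>. These are the
  diagonal entries of the triangular system solved in \<open>inv_gf_relabel\<close>.\<close>

lemma qelem_diag_nonzero: "q \<noteq> 0 \<Longrightarrow> qelem q N N \<noteq> 0"
  by (induction N) (auto simp: qelem_eq_0)

text \<open>The factors \<open>X i\<close> are replaced by \<open>X i + c * D i = a i + b i\<close> one at a time, from the
  largest index down. In the summand of \<open>S\<close>, the index replaced last is \<open>Min S\<close>, and the factors
  beyond it are expanded into \<open>a i\<close> and \<open>b i\<close>.\<close>

lemma prod_diff_expand:
  fixes X D a b :: "'b::linorder \<Rightarrow> 'a::idom"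
  assumes "finite A" "\<And>i. i \<in> A \<Longrightarrow> X i + c * D i = a i + b i"
  shows "(\<Prod>i\<in>A. a i + b i) = (\<Prod>i\<in>A. X i) + c * (\<Sum>S\<in>Pow A - {{}}. \<Prod>i\<in>A.
     if i \<in> S then (if i = Min S then D i else b i) else (if Min S < i then a i else X i))"
  using assms
proof (induction A rule: finite_linorder_min_induct)
  case empty
  then show ?case by simp
next
  case (insert r A)
  let ?t = "\<lambda>S i. if i \<in> S then (if i = Min S then D i else b i) else (if Min S < i then a i else X i)"
  have rA: "r \<notin> A" using insert by auto
  have IH: "(\<Prod>i\<in>A. a i + b i) = (\<Prod>i\<in>A. X i) + c * (\<Sum>S\<in>Pow A - {{}}. \<Prod>i\<in>A. ?t S i)"
    using insert by auto
  \<comment> \<open>Either \<open>r\<close> is missing and keeps its factor \<open>X r\<close>,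
    being below \<open>Min S\<close>, or \<open>r\<close> is the minimum and all other indices are
    expanded.\<close>
  have split: "Pow (insert r A) - {{}} = (Pow A - {{}}) \<union> insert r ` Pow A"
    by (auto simp: Pow_insert)
  have "(\<Sum>S\<in>Pow (insert r A) - {{}}. \<Prod>i\<in>insert r A. ?t S i) =
      (\<Sum>S\<in>Pow A - {{}}. \<Prod>i\<in>insert r A. ?t S i) + (\<Sum>S\<in>insert r ` Pow A. \<Prod>i\<in>insert r A. ?t S i)"
    unfolding split using insert rA by (intro sum.union_disjoint) auto
  also have "(\<Sum>S\<in>Pow A - {{}}. \<Prod>i\<in>insert r A. ?t S i) = (\<Sum>S\<in>Pow A - {{}}. X r * (\<Prod>i\<in>A. ?t S i))"
  proof (rule sum.cong)
    fix S assume S: "S \<in> Pow A - {{}}"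
    then have "Min S \<in> A" using insert(1) by (metis DiffE Min_in PowD finite_subset insertI1 subsetD)
    then have "r < Min S" using insert by blast
    moreover have "r \<notin> S" using S rA by auto
    ultimately have "?t S r = X r" by auto
    then show "(\<Prod>i\<in>insert r A. ?t S i) = X r * (\<Prod>i\<in>A. ?t S i)"
      using insert(1) rA by simp
  qed simp
  also have "(\<Sum>S\<in>insert r ` Pow A. \<Prod>i\<in>insert r A. ?t S i) =
      (\<Sum>T\<in>Pow A. \<Prod>i\<in>insert r A. ?t (insert r T) i)"
    using rA by (subst sum.reindex) (auto simp: inj_on_def)
  also have "\<dots> = (\<Sum>T\<in>Pow A. D r * (\<Prod>i\<in>A. if i \<in> T then b i else a i))"
  proof (rule sum.cong)
    fix T assume T: "T \<in> Pow A"
    then have "finite T" using insert(1) finite_subset by auto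
    then have "Min (insert r T) = r"
      using T insert(2) by (intro Min_eqI) (auto intro: less_imp_le)
    moreover have "(\<Prod>i\<in>A. ?t (insert r T) i) = (\<Prod>i\<in>A. if i \<in> T then b i else a i)"
      using calculation rA insert(2) by (intro prod.cong) auto
    ultimately show "(\<Prod>i\<in>insert r A. ?t (insert r T) i) = D r * (\<Prod>i\<in>A. if i \<in> T then b i else a i)"
      using insert(1) rA by simp
  qed simp
  also have "\<dots> = D r * (\<Prod>i\<in>A. a i + b i)"
  proof -
    have "(\<Sum>T\<in>Pow A. \<Prod>i\<in>A. if i \<in> T then b i else a i) = (\<Prod>i\<in>A. a i + b i)"
    proof -
      have "(\<Prod>i\<in>A. if i \<in> T then b i else a i) = prod b T * prod a (A - T)" if "T \<in> Pow A" for T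
      proof -
        have "{i \<in> A. i \<in> T} = T" "{i \<in> A. i \<notin> T} = A - T" using that by auto
        then show ?thesis using insert(1) by (simp add: prod.If_cases Int_def)
      qed
      then show ?thesis
        using prod_add[OF insert(1), of b a] by (simp add: add.commute)
    qed
    then show ?thesis by (simp add: sum_distrib_left[symmetric])
  qed
  finally have *: "(\<Sum>S\<in>Pow (insert r A) - {{}}. \<Prod>i\<in>insert r A. ?t S i) =
      X r * (\<Sum>S\<in>Pow A - {{}}. \<Prod>i\<in>A. ?t S i) + D r * (\<Prod>i\<in>A. a i + b i)"
    by (simp add: sum_distrib_left)
  have "(\<Prod>i\<in>insert r A. a i + b i) = (X r + c * D r) * (\<Prod>i\<in>A. a i + b i)"
    using insert rA by simp
  also have "\<dots> = X r * (\<Prod>i\<in>A. a i + b i) + c * (D r * (\<Prod>i\<in>A. a i + b i))"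
    by (simp add: algebra_simps)
  \<comment> \<open>The hypothesis is applied only to the copy multiplied by \<open>X r\<close>; the
    other copy is already the sum over the sets containing \<open>r\<close>.\<close>
  also have "X r * (\<Prod>i\<in>A. a i + b i) = X r * (\<Prod>i\<in>A. X i) + c * (X r * (\<Sum>S\<in>Pow A - {{}}. \<Prod>i\<in>A. ?t S i))"
    by (simp only: IH) (simp add: algebra_simps)
  finally show ?case
    using insert(1) rA unfolding * by (simp add: algebra_simps)
qed

section \<open>The product identity and its symmetry in the letters\<close>

text \<open>A letter outside \<open>M\<close> contributes \<open>qelem q N 0 = 1\<close>, so
  products over shrinking supports can share one index set.\<close>

lemma prod_qelem_superset:
  assumes "finite A" "set_mset M \<subseteq> A"
  shows "(\<Prod>i\<in>set_mset M. qelem q N (count M i)) = (\<Prod>i\<in>A. qelem q N (count M i))"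
  using assms by (intro prod.mono_neutral_left) (auto simp: not_in_iff)

lemma size_filter_mset_sum:
  assumes "finite A" "set_mset M \<subseteq> A"
  shows "size (filter_mset P M) = (\<Sum>i\<in>A. if P i then count M i else 0)"
proof -
  have "size (filter_mset P M) = (\<Sum>i\<in>set_mset (filter_mset P M). count (filter_mset P M) i)"
    by (simp add: size_multiset_overloaded_eq)
  also have "\<dots> = (\<Sum>i\<in>A. count (filter_mset P M) i)"
    using assms by (intro sum.mono_neutral_left) (auto simp: not_in_iff)
  finally show ?thesis by simp
qed

text \<open>The two q-Pascal rules write each factor at \<open>Suc N\<close> as
  \<open>X i + c * D i\<close> and as \<open>a i + b i\<close> with \<open>c = q ^ N\<close>, so
  \<open>prod_diff_expand\<close> applies. Its summands carry the weights of
  \<open>inv_gf_Suc\<close>.\<close>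

lemma prod_qelem_Suc:
  "(\<Prod>i\<in>set_mset M. qelem q (Suc N) (count M i)) = (\<Prod>i\<in>set_mset M. qelem q N (count M i)) +
    q ^ N * (\<Sum>S\<in>Pow (set_mset M) - {{}}.
      q ^ size (filter_mset (\<lambda>x. Min S < x) (M - mset_set S)) *
      (\<Prod>i\<in>set_mset (M - mset_set S). qelem q N (count (M - mset_set S) i)))"
proof -
  let ?A = "set_mset M"
  let ?X = "\<lambda>i. qelem q N (count M i)" and ?D = "\<lambda>i. qelem q N (count M i - 1)"
  let ?a = "\<lambda>i. q ^ count M i * qelem q N (count M i)"
  let ?b = "\<lambda>i. q ^ (count M i - 1) * qelem q N (count M i - 1)"
  have rec: "qelem q (Suc N) (count M i) = ?X i + q ^ N * ?D i"
    "qelem q (Suc N) (count M i) = ?a i + ?b i" if "i \<in> ?A" for i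
  proof -
    have "count M i \<noteq> 0" using that by simp
    then obtain c where c: "count M i = Suc c" using not0_implies_Suc by blast
    show "qelem q (Suc N) (count M i) = ?X i + q ^ N * ?D i" by (simp add: c)
    show "qelem q (Suc N) (count M i) = ?a i + ?b i"
      unfolding c using qelem_Suc_Suc'[of q N c] by simp
  qed
  have summand: "(\<Prod>i\<in>?A. if i \<in> S then (if i = Min S then ?D i else ?b i)
        else (if Min S < i then ?a i else ?X i)) =
      q ^ size (filter_mset (\<lambda>x. Min S < x) (M - mset_set S)) *
      (\<Prod>i\<in>set_mset (M - mset_set S). qelem q N (count (M - mset_set S) i))"
    if "S \<in> Pow ?A - {{}}" for S
  proof -
    have fS: "finite S" using that finite_subset by auto
    have sub: "set_mset (M - mset_set S) \<subseteq> ?A" by (meson in_diffD subsetI)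
    have "q ^ size (filter_mset (\<lambda>x. Min S < x) (M - mset_set S)) =
        (\<Prod>i\<in>?A. q ^ (if Min S < i then count (M - mset_set S) i else 0))"
      by (simp only: size_filter_mset_sum[OF finite_set_mset sub] power_sum)
    moreover have "(\<Prod>i\<in>set_mset (M - mset_set S). qelem q N (count (M - mset_set S) i)) =
        (\<Prod>i\<in>?A. qelem q N (count (M - mset_set S) i))"
      by (rule prod_qelem_superset[OF _ sub]) simp
    ultimately have "q ^ size (filter_mset (\<lambda>x. Min S < x) (M - mset_set S)) *
        (\<Prod>i\<in>set_mset (M - mset_set S). qelem q N (count (M - mset_set S) i)) =
        (\<Prod>i\<in>?A. q ^ (if Min S < i then count (M - mset_set S) i else 0) *
          qelem q N (count (M - mset_set S) i))"
      by (simp only: prod.distrib)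
    also have "\<dots> = (\<Prod>i\<in>?A. if i \<in> S then (if i = Min S then ?D i else ?b i)
        else (if Min S < i then ?a i else ?X i))"
    \<comment> \<open>Letters of \<open>S\<close> lose one copy, and exactly the letters above
      \<open>Min S\<close> carry a power of \<open>q\<close>.\<close>
    proof (rule prod.cong[OF refl])
      fix i
      show "q ^ (if Min S < i then count (M - mset_set S) i else 0) * qelem q N (count (M - mset_set S) i) =
          (if i \<in> S then (if i = Min S then ?D i else ?b i) else (if Min S < i then ?a i else ?X i))"
      proof (cases "i \<in> S")
        case True
        then have "Min S < i \<longleftrightarrow> i \<noteq> Min S" using Min_le[OF fS, of i] by auto
        moreover have "count (M - mset_set S) i = count M i - 1" using fS True by simp
        ultimately show ?thesis using True by simp
      qed simp
    qed
    finally show ?thesis ..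
  qed
  have "(\<Prod>i\<in>?A. qelem q (Suc N) (count M i)) = (\<Prod>i\<in>?A. ?a i + ?b i)"
    using rec by (intro prod.cong) auto
  also have "\<dots> = (\<Prod>i\<in>?A. ?X i) + q ^ N * (\<Sum>S\<in>Pow ?A - {{}}. \<Prod>i\<in>?A.
      if i \<in> S then (if i = Min S then ?D i else ?b i) else (if Min S < i then ?a i else ?X i))"
    by (rule prod_diff_expand[OF finite_set_mset trans[OF rec(1)[symmetric] rec(2)]])
  also have "(\<Sum>S\<in>Pow ?A - {{}}. \<Prod>i\<in>?A.
      if i \<in> S then (if i = Min S then ?D i else ?b i) else (if Min S < i then ?a i else ?X i)) =
      (\<Sum>S\<in>Pow ?A - {{}}. q ^ size (filter_mset (\<lambda>x. Min S < x) (M - mset_set S)) *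
      (\<Prod>i\<in>set_mset (M - mset_set S). qelem q N (count (M - mset_set S) i)))"
    by (rule sum.cong[OF refl]) (rule summand)
  finally show ?thesis .
qed

text \<open>Both sides agree at \<open>N = 0\<close> and have the same increment from
  \<open>N\<close> to \<open>Suc N\<close>.\<close>

lemma sum_qelem_inv_gf:
  "(\<Sum>k\<le>N. qelem q N k * inv_gf q M k) = (\<Prod>i\<in>set_mset M. qelem q N (count M i))"
proof (induction N arbitrary: M)
  case 0
  show ?case
  proof (cases "M = {#}")
    case False
    then obtain i where "i \<in># M" by auto
    then have "\<exists>i\<in>set_mset M. qelem q 0 (count M i) = 0"
      by (intro bexI[of _ i]) (auto simp: qelem_eq_0)
    then have "(\<Prod>i\<in>set_mset M. qelem q 0 (count M i)) = 0"
      by (intro prod_zero) auto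
    then show ?thesis using False by (simp add: inv_gf_0)
  qed (simp add: inv_gf_0)
next
  case (Suc N)
  have "(\<Sum>k\<le>Suc N. qelem q (Suc N) k * inv_gf q M k) =
      inv_gf q M 0 + (\<Sum>k\<le>N. qelem q N (Suc k) * inv_gf q M (Suc k)) +
      q ^ N * (\<Sum>k\<le>N. qelem q N k * inv_gf q M (Suc k))"
    by (simp add: sum.atMost_Suc_shift sum.distrib sum_distrib_left algebra_simps del: sum.atMost_Suc)
  also have "inv_gf q M 0 + (\<Sum>k\<le>N. qelem q N (Suc k) * inv_gf q M (Suc k)) =
      (\<Sum>k\<le>Suc N. qelem q N k * inv_gf q M k)"
    by (simp add: sum.atMost_Suc_shift del: sum.atMost_Suc)
  \<comment> \<open>The top term vanishes because \<open>qelem q N (Suc N) = 0\<close>.\<close>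
  also have "\<dots> = (\<Prod>i\<in>set_mset M. qelem q N (count M i))"
    by (simp add: qelem_eq_0 Suc)
  also have "(\<Sum>k\<le>N. qelem q N k * inv_gf q M (Suc k)) = (\<Sum>S\<in>Pow (set_mset M) - {{}}.
      q ^ size (filter_mset (\<lambda>x. Min S < x) (M - mset_set S)) *
      (\<Sum>k\<le>N. qelem q N k * inv_gf q (M - mset_set S) k))"
    unfolding inv_gf_Suc sum_distrib_left by (subst sum.swap) (simp add: mult.left_commute)
  finally show ?case
    unfolding Suc prod_qelem_Suc .
qed

text \<open>The right-hand side of \<open>sum_qelem_inv_gf\<close> sees only the multiplicities. At
  \<open>N = k\<close> all terms below \<open>k\<close> agree by induction, and the coefficient of
  the last one is nonzero and cancels.\<close>

lemma inv_gf_relabel: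
  assumes "q \<noteq> 0" "inj_on f (set_mset M)"
  shows "inv_gf q (image_mset f M) k = inv_gf q M k"
proof (induction k rule: less_induct)
  case (less k)
  have cnt: "count (image_mset f M) (f i) = count M i" if "i \<in># M" for i
  proof -
    have "f -` {f i} \<inter> set_mset M = {i}"
      using assms(2) that by (auto dest: inj_onD)
    then show ?thesis by (simp add: count_image_mset)
  qed
  have "(\<Prod>j\<in>set_mset (image_mset f M). qelem q k (count (image_mset f M) j)) =
      (\<Prod>i\<in>set_mset M. qelem q k (count M i))"
    using assms(2) cnt by (simp add: prod.reindex)
  then have "(\<Sum>j\<le>k. qelem q k j * inv_gf q (image_mset f M) j) = (\<Sum>j\<le>k. qelem q k j * inv_gf q M j)"
    by (simp only: sum_qelem_inv_gf)
  moreover have "(\<Sum>j<k. qelem q k j * inv_gf q (image_mset f M) j) = (\<Sum>j<k. qelem q k j * inv_gf q M j)"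
    using less by simp
  ultimately have "qelem q k k * inv_gf q (image_mset f M) k = qelem q k k * inv_gf q M k"
    by (simp add: lessThan_Suc_atMost[symmetric])
  then show ?case
    using qelem_diag_nonzero[OF assms(1)] by simp
qed

section \<open>The minimaj generating function\<close>

lemma maj_Nil [simp]: "maj [] = 0"
  by (simp add: maj_def)

lemma maj_singleton [simp]: "maj [x] = 0"
  by (simp add: maj_def)

lemma maj_snoc: "maj (w @ [x]) = maj w + (if w \<noteq> [] \<and> x < last w then length w else 0)"
proof -
  let ?D = "{i. Suc i < length w \<and> w ! i > w ! Suc i}"
  have "{i. Suc i < length (w @ [x]) \<and> (w @ [x]) ! i > (w @ [x]) ! Suc i} =
      ?D \<union> (if w \<noteq> [] \<and> x < last w then {length w - 1} else {})"
  proof (rule set_eqI)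
    fix i
    consider "Suc i < length w" | "Suc i = length w" | "length w < Suc i" by linarith
    then show "i \<in> {i. Suc i < length (w @ [x]) \<and> (w @ [x]) ! i > (w @ [x]) ! Suc i} \<longleftrightarrow>
        i \<in> ?D \<union> (if w \<noteq> [] \<and> x < last w then {length w - 1} else {})"
    proof cases
      case 1
      then show ?thesis by (auto simp: nth_append)
    next
      case 2
      then have "w \<noteq> []" "i = length w - 1" by auto
      moreover from this have "last w = w ! i" by (simp add: last_conv_nth)
      ultimately show ?thesis using 2 by (auto simp: nth_append)
    next
      case 3
      then show ?thesis by auto
    qed
  qed
  moreover have "finite ?D" by (rule finite_subset[of _ "{..<length w}"]) auto
  ultimately show ?thesis
    by (auto simp: maj_def sum.union_disjoint)
qed

lemma maj_append_ge: "maj w \<le> maj (w @ u)"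
proof (induction u rule: rev_induct)
  case (snoc x u)
  then show ?case using maj_snoc[of "w @ u" x] by (simp del: append_assoc add: append_assoc[symmetric])
qed simp

text \<open>Suppose the word ends in \<open>x\<close>. If a larger letter of \<open>u\<close>
  precedes it, that descent costs at least \<open>length w\<close>. Otherwise the preceding letter
  is at most \<open>x\<close>, so it costs at least as much directly after \<open>w\<close>, and
  induction applies to it.\<close>

lemma maj_append_ge_snoc: "x \<in> set u \<Longrightarrow> maj (w @ [x]) \<le> maj (w @ u)"
proof (induction u arbitrary: x rule: rev_induct)
  case (snoc z u)
  have app: "maj (w @ u @ [z]) = maj (w @ u) + (if w @ u \<noteq> [] \<and> z < last (w @ u) then length (w @ u) else 0)"
    using maj_snoc[of "w @ u" z] by simp
  consider "x \<in> set u" | "u = []" "x = z" | "u \<noteq> []" "x = z" using snoc.prems by auto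
  then show ?case
  proof cases
    case 1
    then show ?thesis using snoc.IH[of x] app by simp
  next
    case 2
    then show ?thesis by simp
  next
    case 3
    let ?y = "last u"
    have IH: "maj (w @ [?y]) \<le> maj (w @ u)" using 3 snoc.IH by simp
    show ?thesis
    proof (cases "x < ?y")
      case True
      then show ?thesis using app 3 maj_append_ge[of w u] maj_snoc[of w x] by simp
    next
      case False
      then have "maj (w @ [x]) \<le> maj (w @ [?y])" by (simp add: maj_snoc)
      then show ?thesis using IH app by simp
    qed
  qed
qed simp

lemma maj_append_sorted: "sorted (x # u) \<Longrightarrow> maj (w @ x # u) = maj (w @ [x])"
proof (induction u rule: rev_induct)
  case (snoc z u)
  have s: "sorted (x # u)" "last (x # u) \<le> z"
    using snoc.prems sorted_append[of "x # u" "[z]"] by auto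
  have "maj ((w @ x # u) @ [z]) = maj (w @ x # u)"
    using s(2) by (subst maj_snoc) simp
  then show ?case using snoc.IH s(1) by simp
qed simp

text \<open>Only the relative order of the new labels matters, so the cyclic rotation of the alphabet
  \<open>{..<L}\<close> that makes \<open>r\<close> its largest letter is realised by lifting the letters up to \<open>r\<close>.\<close>

definition rot :: "nat \<Rightarrow> nat \<Rightarrow> nat \<Rightarrow> nat" where
  "rot L r x = (if x \<le> r then x + L else x)"

lemma inj_on_rot: "inj_on (rot L r) {..<L}"
  by (auto simp: inj_on_def rot_def split: if_splits)

text \<open>The boundary term on the left is the descent that a final \<open>r\<close> would create.
  Rotation changes the comparison of neighbours only if exactly one exceeds \<open>r\<close>; the
  change of the boundary term compensates for this, up to one unit for each new letter above
  \<open>r\<close>.\<close>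

lemma maj_rot_nonempty:
  assumes "set (v @ [x]) \<subseteq> {..<L}"
  shows "maj (v @ [x]) + (if r < x then Suc (length v) else 0) =
    maj (map (rot L r) (v @ [x])) + length (filter (\<lambda>y. r < y) (v @ [x]))"
  using assms
proof (induction v arbitrary: x rule: rev_induct)
  case Nil
  then show ?case by (simp add: maj_snoc[of "[]", simplified])
next
  case (snoc y v)
  let ?f = "rot L r"
  have IH: "maj (v @ [y]) + (if r < y then Suc (length v) else 0) =
      maj (map ?f (v @ [y])) + length (filter (\<lambda>y. r < y) (v @ [y]))"
    using snoc by simp
  have m1: "maj ((v @ [y]) @ [x]) = maj (v @ [y]) + (if x < y then Suc (length v) else 0)"
    by (subst maj_snoc) simp
  have m2: "maj (map ?f ((v @ [y]) @ [x])) =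
      maj (map ?f (v @ [y])) + (if ?f x < ?f y then Suc (length v) else 0)"
    using maj_snoc[of "map ?f (v @ [y])" "?f x"] by simp
  \<comment> \<open>Lifted letters are at least \<open>L\<close>, hence above all letters that
    stay.\<close>
  have "x < L" "y < L" using snoc.prems by auto
  then show ?case
    unfolding m1 m2 using IH by (auto simp: rot_def split: if_splits)
qed

lemma maj_snoc_rot:
  assumes "set w \<subseteq> {..<L}"
  shows "maj (w @ [r]) = maj (map (rot L r) w) + size (filter_mset (\<lambda>y. r < y) (mset w))"
proof (cases w rule: rev_cases)
  case Nil
  then show ?thesis by (simp add: maj_snoc)
next
  case (snoc v x)
  have "maj (w @ [r]) = maj w + (if r < x then Suc (length v) else 0)"
    unfolding maj_snoc[of w r] by (simp add: snoc)
  also have "\<dots> = maj (map (rot L r) w) + length (filter (\<lambda>y. r < y) w)"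
    using maj_rot_nonempty[of v x L r] assms unfolding snoc by blast
  also have "length (filter (\<lambda>y. r < y) w) = size (filter_mset (\<lambda>y. r < y) (mset w))"
    by (simp only: mset_filter[symmetric] size_mset)
  finally show ?thesis .
qed

section \<open>Words of a sequence of blocks and the last block\<close>

lemma block_words_snoc:
  "block_words (\<mu> @ [S]) = {w @ u | w u. w \<in> block_words \<mu> \<and> distinct u \<and> set u = S}"
proof (intro set_eqI iffI)
  let ?P = "\<lambda>u B. distinct u \<and> set u = B"
  fix x assume "x \<in> block_words (\<mu> @ [S])"
  then obtain ws where ws: "x = concat ws" "list_all2 ?P ws (\<mu> @ [S])"
    by (auto simp: block_words_def)
  then obtain ws1 ws2 where ws': "ws = ws1 @ ws2" "list_all2 ?P ws1 \<mu>" "list_all2 ?P ws2 [S]"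
    unfolding list_all2_append2 by blast
  then obtain u where "ws2 = [u]" "distinct u" "set u = S"
    by (auto simp: list_all2_Cons2)
  moreover have "concat ws1 \<in> block_words \<mu>" using ws' by (auto simp: block_words_def)
  ultimately show "x \<in> {w @ u | w u. w \<in> block_words \<mu> \<and> distinct u \<and> set u = S}"
    using ws ws' by auto
next
  let ?P = "\<lambda>u B. distinct u \<and> set u = B"
  fix x assume "x \<in> {w @ u | w u. w \<in> block_words \<mu> \<and> distinct u \<and> set u = S}"
  then obtain ws u where "x = concat (ws @ [u])" "list_all2 ?P ws \<mu>" "distinct u" "set u = S"
    by (auto simp: block_words_def)
  moreover from this have "list_all2 ?P (ws @ [u]) (\<mu> @ [S])"
    by (intro list_all2_appendI) simp_all
  ultimately show "x \<in> block_words (\<mu> @ [S])"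
    unfolding block_words_def by blast
qed

lemma distinct_lists_image:
  assumes "inj_on f B"
  shows "{u. distinct u \<and> set u = f ` B} = map f ` {u. distinct u \<and> set u = B}"
proof (intro set_eqI iffI)
  fix u assume u: "u \<in> {u. distinct u \<and> set u = f ` B}"
  let ?v = "map (the_inv_into B f) u"
  have "map f ?v = u"
    using u assms by (auto simp: f_the_inv_into_f intro!: map_idI)
  moreover have "distinct ?v"
    using u assms by (auto simp: distinct_map inj_on_the_inv_into)
  moreover have "set ?v = B"
    using u assms by (auto simp: the_inv_into_onto)
  ultimately show "u \<in> map f ` {u. distinct u \<and> set u = B}"
    by (metis (mono_tags, lifting) image_eqI mem_Collect_eq)
qed (use assms in \<open>auto simp: distinct_map\<close>)

lemma block_words_image:
  assumes "inj_on f (\<Union>(set \<mu>))"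
  shows "block_words (map ((`) f) \<mu>) = map f ` block_words \<mu>"
  using assms
proof (induction \<mu>)
  case Nil
  then show ?case by (simp add: block_words_Nil)
next
  case (Cons B \<mu>)
  have "inj_on f B" "inj_on f (\<Union>(set \<mu>))"
    using Cons.prems by (auto intro: inj_on_subset)
  then have "block_words (map ((`) f) (B # \<mu>)) =
      (\<lambda>(u, w). u @ w) ` (map f ` {u. distinct u \<and> set u = B} \<times> map f ` block_words \<mu>)"
    using Cons.IH by (simp add: block_words_Cons distinct_lists_image)
  also have "\<dots> = map f ` block_words (B # \<mu>)"
    unfolding block_words_Cons by (force simp: image_iff)
  finally show ?case .
qed

lemma mset_block_word:
  assumes "w \<in> block_words \<mu>"
  shows "mset w = sum_list (map mset_set \<mu>)"
  using assms
proof (induction \<mu> arbitrary: w)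
  case (Cons B \<mu>)
  then show ?case by (auto simp: block_words_Cons mset_set_set)
qed (simp add: block_words_Nil)

text \<open>Whatever precedes it, the last block is best written in increasing order and then costs
  no more than its first letter \<open>Min S\<close>. By \<open>maj_snoc_rot\<close> this letter
  shifts the rotated maj by the same constant for all earlier words, as these share the letter
  multiset \<open>M\<close>.\<close>

lemma minimaj_snoc:
  assumes mu: "\<mu> \<in> omp M k" and S: "finite S" "S \<noteq> {}" and L: "set_mset M \<subseteq> {..<L}"
  shows "minimaj (\<mu> @ [S]) = minimaj (map ((`) (rot L (Min S))) \<mu>) +
    size (filter_mset (\<lambda>x. Min S < x) M)"
proof -
  let ?r = "Min S" and ?c = "size (filter_mset (\<lambda>x. Min S < x) M)"
  let ?f = "rot L ?r"
  have fin: "finite B" if "B \<in> set \<mu>" for B using finite_block_omp[OF mu that] .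
  have "inj_on ?f (\<Union>(set \<mu>))"
    using Union_omp[OF mu] L inj_on_rot inj_on_subset by metis
  note img = block_words_image[OF this]
  have word: "maj (w @ [?r]) = maj (map ?f w) + ?c" if "w \<in> block_words \<mu>" for w
  proof -
    have "mset w = M" using mset_block_word[OF that] mu by (simp add: omp_def)
    moreover from this have "set w \<subseteq> {..<L}" using L by auto
    ultimately show ?thesis using maj_snoc_rot by metis
  qed
  let ?V = "maj ` map ?f ` block_words \<mu>"
  have fV: "finite ?V" "?V \<noteq> {}" using finite_block_words[of \<mu>] fin by auto
  have mm: "minimaj (map ((`) ?f) \<mu>) = Min ?V" by (simp add: minimaj_def img)
  \<comment> \<open>A minimiser after rotation, followed by \<open>S\<close> in increasing order,
    attains the lower bound.\<close>
  obtain w0 where w0: "w0 \<in> block_words \<mu>" "maj (map ?f w0) = Min ?V"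
    using Min_in[OF fV] by auto
  define u where "u = sorted_list_of_set (S - {?r})"
  have "sorted_list_of_set S = ?r # u"
    using S by (simp add: u_def sorted_list_of_set_nonempty)
  then have u: "sorted (?r # u)" "distinct (?r # u)" "set (?r # u) = S"
    using sorted_sorted_list_of_set[of S] distinct_sorted_list_of_set[of S] set_sorted_list_of_set[OF S(1)]
    by simp_all
  have "minimaj (\<mu> @ [S]) = Min ?V + ?c"
    unfolding minimaj_def
  proof (rule Min_eqI)
    show "finite (maj ` block_words (\<mu> @ [S]))"
      using finite_block_words[of "\<mu> @ [S]"] fin S by auto
  next
    fix y assume "y \<in> maj ` block_words (\<mu> @ [S])"
    then obtain w v where w: "w \<in> block_words \<mu>" "set v = S" "y = maj (w @ v)"
      by (auto simp: block_words_snoc)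
    then have "maj (w @ [?r]) \<le> y" using maj_append_ge_snoc[of ?r v w] S by simp
    moreover have "Min ?V \<le> maj (map ?f w)" using fV w by (intro Min_le) auto
    ultimately show "Min ?V + ?c \<le> y" using word[OF w(1)] by simp
  next
    have "maj (w0 @ ?r # u) = Min ?V + ?c"
      using maj_append_sorted[OF u(1)] word[OF w0(1)] w0(2) by simp
    moreover have "w0 @ ?r # u \<in> block_words (\<mu> @ [S])"
      using w0 u unfolding block_words_snoc by blast
    ultimately show "Min ?V + ?c \<in> maj ` block_words (\<mu> @ [S])" by (metis image_eqI)
  qed
  then show ?thesis using mm by simp
qed

text \<open>The rotation depends on \<open>S\<close>, so it is undone separately for each last
  block: \<open>sum_omp_relabel\<close> moves it to the weight, the induction hypothesis passes to
  \<open>inv_gf\<close>, and \<open>inv_gf_relabel\<close> removes it.\<close>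

lemma minimaj_gf_eq_inv_gf:
  assumes "q \<noteq> 0"
  shows "(\<Sum>\<mu>\<in>omp M k. q ^ minimaj \<mu>) = inv_gf q M k"
proof (induction k arbitrary: M)
  case 0
  then show ?case by (simp add: inv_gf_0 omp_0 minimaj_def block_words_Nil)
next
  case (Suc k)
  have "(\<Sum>\<nu>\<in>omp (M - mset_set S) k. q ^ minimaj (\<nu> @ [S])) =
      q ^ size (filter_mset (\<lambda>x. Min S < x) (M - mset_set S)) * inv_gf q (M - mset_set S) k"
    if "S \<in> Pow (set_mset M) - {{}}" for S
  proof -
    let ?M = "M - mset_set S"
    obtain L where L: "set_mset ?M \<subseteq> {..<L}"
      using finite_nat_iff_bounded[of "set_mset ?M"] by auto
    let ?f = "rot L (Min S)" and ?c = "size (filter_mset (\<lambda>x. Min S < x) ?M)"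
    have inj: "inj_on ?f (set_mset ?M)" using inj_on_rot L by (rule inj_on_subset)
    have S: "finite S" "S \<noteq> {}" using that finite_subset by auto
    have "(\<Sum>\<nu>\<in>omp ?M k. q ^ minimaj (\<nu> @ [S])) =
        q ^ ?c * (\<Sum>\<nu>\<in>omp ?M k. q ^ minimaj (map ((`) ?f) \<nu>))"
      unfolding sum_distrib_left
      by (rule sum.cong) (simp_all add: minimaj_snoc[OF _ S L] power_add)
    also have "(\<Sum>\<nu>\<in>omp ?M k. q ^ minimaj (map ((`) ?f) \<nu>)) =
        (\<Sum>\<nu>\<in>omp (image_mset ?f ?M) k. q ^ minimaj \<nu>)"
      by (rule sum_omp_relabel[OF inj])
    also have "\<dots> = inv_gf q ?M k"
      unfolding Suc using inv_gf_relabel[OF assms inj] .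
    finally show ?thesis .
  qed
  then show ?case by (simp add: sum_omp_Suc inv_gf_Suc)
qed

theorem theorem3p17:
  fixes \<beta> :: "nat list" and n k :: nat
  assumes "weak_composition n \<beta>"
  shows "(\<Sum>\<mu>\<in>ordered_multiset_partitions \<beta> k. monom (1::int) (inv_stat \<mu>)) =
         (\<Sum>\<mu>\<in>ordered_multiset_partitions \<beta> k. monom (1::int) (minimaj \<mu>))"
proof -
  \<comment> \<open>The indeterminate is a nonzero element of an integral domain and can serve as
    \<open>q\<close>.\<close>
  have "monom (1::int) m = [:0, 1:] ^ m" for m
    by (simp add: monom_altdef)
  then show ?thesis
    using minimaj_gf_eq_inv_gf[of "[:0, 1::int:]" "weight_mset \<beta>" k]
    by (simp add: ordered_multiset_partitions_eq_omp inv_gf_def)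
qed

end
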